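(* Let $n\in\mathbb N_0$, $t\in\mathbb C$, let $\alpha,\beta>0$ be real, and let $c\in(0,1)$. Then $$\sum_{x=0}^{\infty}{}_1F_1\!\left(\begin{matrix}-x\\ \alpha\end{matrix};\frac{t(1-c)}{c}\right)M_n(x;\beta,c)\,\frac{(\beta)_x\,c^x}{x!}=\frac{t^n e^{-t}}{(1-c)^{\beta}(\alpha)_n\,c^n}\;{}_1F_1\!\left(\begin{matrix}\alpha-\beta\\ \alpha+n\end{matrix};t\right).$$
   Context: $\mathbb N_0=\{0,1,2,\dots\}$. Pochhammer symbol: $(a)_n=a(a+1)\cdots(a+n-1)$, $(a)_0=1$. ${}_1F_1\!\left(\begin{matrix}a\\ b\end{matrix};z\right)=\sum_{k\ge0}\frac{(a)_k}{(b)_k}\frac{z^k}{k!}$. Meixner polynomials: $M_n(x;\beta,c)={}_2F_1\!\left(\begin{matrix}-n,\,-x\\ \beta\end{matrix};1-\frac1c\right)=\sum_{k=0}^n\frac{(-n)_k(-x)_k}{(\beta)_k\,k!}\left(1-\frac1c\right)^k$. *)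

theory Defs
  imports Complex_Main
begin

definition hyp1F1 :: "'a \<Rightarrow> 'a \<Rightarrow> 'a \<Rightarrow> 'a :: real_normed_field" where
  "hyp1F1 a b z = (\<Sum>k. pochhammer a k / pochhammer b k * z ^ k / fact k)"

definition hyp2F1 :: "'a \<Rightarrow> 'a \<Rightarrow> 'a \<Rightarrow> 'a \<Rightarrow> 'a :: real_normed_field" where
  "hyp2F1 a b c z =
     (\<Sum>k. pochhammer a k * pochhammer b k / (pochhammer c k * fact k) * z ^ k)"

definition meixner :: "nat \<Rightarrow> real \<Rightarrow> real \<Rightarrow> real \<Rightarrow> real" where
  "meixner n x \<beta> c = hyp2F1 (- real n) (- x) \<beta> (1 - 1 / c)"

text \<open>
  The series defining a Meixner polynomial terminates, so no condition on
  \<open>1 - 1 / c\<close> is needed for its convergence.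
\<close>

lemma meixner_altdef:
  "meixner n x \<beta> c =
     (\<Sum>k\<le>n. pochhammer (- real n) k * pochhammer (- x) k / (pochhammer \<beta> k * fact k)
              * (1 - 1 / c) ^ k)"
  unfolding meixner_def hyp2F1_def
  by (rule suminf_finite) (auto simp: pochhammer_of_nat_eq_0_lemma)

end

theory Submission
  imports Defs "HOL-Analysis.Generalised_Binomial_Theorem" "HOL-Analysis.Infinite_Sum"
begin

text \<open>
  Write \<open>w\<^sub>\<beta> x = (\<beta>)\<^sub>x c\<^sup>x / x!\<close> for the weight and \<open>T n \<alpha> \<beta>\<close> for the sum of
  \<open>\<^sub>1F\<^sub>1(-x; \<alpha>; z) M\<^sub>n(x; \<beta>, c) w\<^sub>\<beta> x\<close> over \<open>x\<close>. The sum is evaluated by lowering the degree \<open>n\<close>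
  while \<open>z\<close> stays fixed.

  The Meixner polynomials satisfy a discrete Rodrigues formula: the function
  \<open>M\<^sub>n\<^sub>+\<^sub>1(x; \<beta>, c) w\<^sub>\<beta> x\<close> is the backward difference of
  \<open>M\<^sub>n(x; \<beta> + 1, c) w\<^sub>\<beta>\<^sub>+\<^sub>1 x\<close> (\<open>meixner_backward_shift\<close>). Summation by parts
  (\<open>sums_by_parts\<close>) moves the difference to the other factor, and the forward difference of
  \<open>\<^sub>1F\<^sub>1(-x; \<alpha>; z)\<close> in \<open>x\<close> is \<open>-(z / \<alpha>) \<^sub>1F\<^sub>1(-x; \<alpha> + 1; z)\<close>
  (\<open>hyp1F1_diff_upper\<close>). Hence \<open>T (n + 1) \<alpha> \<beta> = (z / \<alpha>) T n (\<alpha> + 1) (\<beta> + 1)\<close>. The boundary term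
  vanishes because, for every \<open>\<epsilon> > 0\<close>, both hypergeometric factors are at most of the order
  \<open>(1 + \<epsilon>)\<^sup>x\<close>, whereas the weight decays like \<open>c\<^sup>x\<close> up to a power of \<open>x\<close>.

  This reduces everything to \<open>T 0 \<alpha> \<beta>\<close>. Expanding \<open>\<^sub>1F\<^sub>1(-x; \<alpha>; z)\<close> gives an absolutely convergent
  double series. After the order of summation is exchanged, each inner sum is a binomial series,
  and \<open>T 0 \<alpha> \<beta> = (1 - c)\<^sup>-\<^sup>\<beta> \<^sub>1F\<^sub>1(\<beta>; \<alpha>; -z c / (1 - c))\<close> (\<open>hyp1F1_weight_sums\<close>). With
  \<open>z = t (1 - c) / c\<close> the last argument is \<open>-t\<close>, and Kummer's transformation
  (\<open>kummer_transformation\<close>) produces the factor \<open>exp (-t)\<close>.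
\<close>

section \<open>Confluent hypergeometric series\<close>

text \<open>
  The ratio of consecutive terms tends to \<open>0\<close>. The recursion between the terms also holds when
  \<open>b\<close> is a nonpositive integer, because the terms then vanish from some index on by the convention
  \<open>x / 0 = 0\<close>.
\<close>

lemma summable_norm_hyp1F1:
  fixes a b z :: "'a :: {real_normed_field, banach}"
  shows "summable (\<lambda>k. norm (pochhammer a k / pochhammer b k * z ^ k / fact k))"
proof -
  define f where "f = (\<lambda>k. pochhammer a k / pochhammer b k * z ^ k / fact k)"
  define r where "r = (\<lambda>k. (a + of_nat k) / (b + of_nat k) * (z / of_nat (Suc k)))"
  have step: "f (Suc k) = r k * f k" for k
    by (simp add: f_def r_def pochhammer_Suc mult_ac)
  have A: "(\<lambda>k. (c + of_nat k) / of_nat k) \<longlonglongrightarrow> 1" for c :: 'a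
  proof (rule Lim_transform_eventually)
    show "(\<lambda>k. c / of_nat k + 1) \<longlonglongrightarrow> 1"
      using tendsto_add[OF lim_const_over_n[of c] tendsto_const[of 1]] by simp
    show "\<forall>\<^sub>F k in sequentially. c / of_nat k + 1 = (c + of_nat k) / of_nat k"
      using eventually_gt_at_top[of 0] by eventually_elim (simp add: field_simps)
  qed
  have B: "(\<lambda>k. (a + of_nat k) / (b + of_nat k)) \<longlonglongrightarrow> 1"
  proof (rule Lim_transform_eventually)
    show "(\<lambda>k. ((a + of_nat k) / of_nat k) / ((b + of_nat k) / of_nat k)) \<longlonglongrightarrow> 1"
      using tendsto_divide[OF A[of a] A[of b]] by simp
    show "\<forall>\<^sub>F k in sequentially. ((a + of_nat k) / of_nat k) / ((b + of_nat k) / of_nat k)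
            = (a + of_nat k) / (b + of_nat k)"
      using eventually_gt_at_top[of 0] by eventually_elim simp
  qed
  have "(\<lambda>k. z / of_nat (Suc k)) \<longlonglongrightarrow> 0"
    using LIMSEQ_Suc[OF lim_const_over_n[of z]] .
  from tendsto_mult[OF B this] have "r \<longlonglongrightarrow> 0"
    by (simp add: r_def)
  then have "\<forall>\<^sub>F k in sequentially. norm (r k) < 1 / 2"
    using tendstoD[of r 0 sequentially "1/2"] by simp
  then obtain N where N: "\<And>k. k \<ge> N \<Longrightarrow> norm (r k) < 1 / 2"
    by (auto simp: eventually_sequentially)
  have "summable (\<lambda>k. norm (f k))"
  proof (rule summable_ratio_test[of "1/2" N])
    fix k assume "k \<ge> N"
    from mult_right_mono[OF less_imp_le[OF N[OF this]], of "norm (f k)"]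
    show "norm (norm (f (Suc k))) \<le> 1 / 2 * norm (norm (f k))"
      by (simp add: step norm_mult)
  qed simp
  then show ?thesis
    by (simp add: f_def)
qed

lemma hyp1F1_sums:
  fixes a b z :: "'a :: {real_normed_field, banach}"
  shows "(\<lambda>k. pochhammer a k / pochhammer b k * z ^ k / fact k) sums hyp1F1 a b z"
  unfolding hyp1F1_def
  by (rule summable_sums[OF summable_norm_cancel[OF summable_norm_hyp1F1]])

lemma pochhammer_neg_nat:
  "pochhammer (- of_nat n) k = ((- 1) ^ k * of_nat (n choose k) * fact k :: 'a :: field_char_0)"
  by (simp add: binomial_gbinomial gbinomial_pochhammer)

text \<open>
  As a binomial transform of \<open>(-z)\<^sup>k / (b)\<^sub>k\<close>, the terminating series can be bounded by the binomial
  theorem and resummed over \<open>x\<close>.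
\<close>

lemma hyp1F1_neg_nat:
  fixes b z :: "'a :: real_normed_field"
  shows "hyp1F1 (- of_nat x) b z = (\<Sum>k\<le>x. of_nat (x choose k) * ((- z) ^ k / pochhammer b k))"
proof -
  have "hyp1F1 (- of_nat x) b z
        = (\<Sum>k\<le>x. pochhammer (- of_nat x) k / pochhammer b k * z ^ k / fact k)"
    unfolding hyp1F1_def
    by (rule suminf_finite) (auto simp: pochhammer_of_nat_eq_0_lemma)
  also have "\<dots> = (\<Sum>k\<le>x. of_nat (x choose k) * ((- z) ^ k / pochhammer b k))"
    by (rule sum.cong[OF refl])
       (simp add: pochhammer_neg_nat power_minus[of z] mult_ac)
  finally show ?thesis .
qed

text \<open>
  With \<open>a = -x\<close> this is a forward difference in \<open>x\<close>. Termwise it is the identity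
  \<open>(a - 1)\<^sub>k\<^sub>+\<^sub>1 - (a)\<^sub>k\<^sub>+\<^sub>1 = -(k + 1) (a)\<^sub>k\<close>, which cancels one factor of \<open>(k + 1)!\<close> and so
  shifts the series by one index.
\<close>

lemma hyp1F1_diff_upper:
  fixes a b z :: "'a :: {real_normed_field, banach}"
  shows "hyp1F1 (a - 1) b z - hyp1F1 a b z = - (z / b) * hyp1F1 a (b + 1) z"
proof -
  define d where "d = (\<lambda>k. pochhammer (a - 1) k / pochhammer b k * z ^ k / fact k
                         - pochhammer a k / pochhammer b k * z ^ k / fact k)"
  have d: "d sums (hyp1F1 (a - 1) b z - hyp1F1 a b z)"
    unfolding d_def by (intro sums_diff hyp1F1_sums)
  have dSuc: "d (Suc k) = - (z / b) * (pochhammer a k / pochhammer (b + 1) k * z ^ k / fact k)" for k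
  proof -
    have "pochhammer (a - 1) (Suc k) - pochhammer a (Suc k) = - of_nat (Suc k) * pochhammer a k"
      by (simp only: pochhammer_rec[of "a - 1"] pochhammer_rec'[of a]) (simp add: algebra_simps)
    then have "d (Suc k) = - of_nat (Suc k) * pochhammer a k / pochhammer b (Suc k)
                             * z ^ Suc k / fact (Suc k)"
      by (simp only: d_def flip: diff_divide_distrib left_diff_distrib)
    also have "\<dots> = - (z / b) * (pochhammer a k / pochhammer (b + 1) k * z ^ k / fact k)"
      by (simp add: pochhammer_rec[of b] del: of_nat_Suc)
    finally show ?thesis .
  qed
  have "(\<lambda>k. d (Suc k)) sums (- (z / b) * hyp1F1 a (b + 1) z)"
    unfolding dSuc by (intro sums_mult hyp1F1_sums)
  then have "d sums (- (z / b) * hyp1F1 a (b + 1) z)"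
    by (subst (asm) sums_Suc_iff) (simp add: d_def)
  with d show ?thesis
    by (rule sums_unique2)
qed

text \<open>
  The reflection \<open>(1 - b - n)\<^sub>n\<^sub>-\<^sub>k = (-1)\<^sup>n\<^sup>-\<^sup>k (b + k)\<^sub>n\<^sub>-\<^sub>k\<close> turns the sum into the binomial theorem for
  rising factorials at \<open>a + (1 - b - n)\<close>, and a second reflection turns that value into
  \<open>(b - a)\<^sub>n\<close>.
\<close>

lemma chu_vandermonde:
  fixes a b :: "'a :: field_char_0"
  assumes "pochhammer b n \<noteq> 0"
  shows "(\<Sum>k\<le>n. of_nat (n choose k) * (- 1) ^ k * pochhammer a k / pochhammer b k)
           = pochhammer (b - a) n / pochhammer b n"
proof -
  have refl1: "(- 1) ^ k * pochhammer (1 - b - of_nat n) (n - k) * (- 1) ^ n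
      = pochhammer b n / pochhammer b k" if "k \<le> n" for k
  proof -
    have nz: "pochhammer b k \<noteq> 0"
      using assms that by (rule pochhammer_neq_0_mono)
    have "pochhammer (- (b + of_nat n - 1)) (n - k)
          = (- 1) ^ (n - k) * pochhammer (b + of_nat n - 1 - of_nat (n - k) + 1) (n - k)"
      by (rule pochhammer_minus)
    also have "b + of_nat n - 1 - of_nat (n - k) + 1 = b + of_nat k"
      using that by (simp add: of_nat_diff)
    finally have "pochhammer (1 - b - of_nat n) (n - k) = (- 1) ^ (n - k) * pochhammer (b + of_nat k) (n - k)"
      by (simp add: algebra_simps)
    moreover have "pochhammer b n = pochhammer b k * pochhammer (b + of_nat k) (n - k)"
      using that by (rule pochhammer_product)
    moreover have "(- 1) ^ k * (- 1) ^ (n - k) * (- 1) ^ n = (1 :: 'a)"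
      using that by (simp flip: power_add add: mult.assoc)
    ultimately show ?thesis
      using nz by (simp add: field_simps)
  qed
  have "pochhammer (b - a) n = (- 1) ^ n * pochhammer (- (b - a + of_nat n - 1)) n"
    using pochhammer_minus[of "b - a + of_nat n - 1" n] by simp
  also have "- (b - a + of_nat n - 1) = a + (1 - b - of_nat n)"
    by simp
  also have "(- 1) ^ n * pochhammer \<dots> n = (\<Sum>k\<le>n. of_nat (n choose k) * (- 1) ^ k * pochhammer a k *
       ((- 1) ^ k * pochhammer (1 - b - of_nat n) (n - k) * (- 1) ^ n))"
    unfolding pochhammer_binomial_sum sum_distrib_left
    by (rule sum.cong[OF refl]) (simp add: mult_ac)
  also have "\<dots> = (\<Sum>k\<le>n. of_nat (n choose k) * (- 1) ^ k * pochhammer a k * (pochhammer b n / pochhammer b k))"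
    by (rule sum.cong[OF refl]) (simp only: refl1 atMost_iff)
  finally show ?thesis
    using assms by (simp add: field_simps sum_distrib_left)
qed

text \<open>
  The Cauchy product of \<open>exp (-t)\<close> with the series of \<open>\<^sub>1F\<^sub>1(a; b; t)\<close> has Chu--Vandermonde sums as its
  coefficients.
\<close>

lemma kummer_transformation:
  fixes a b t :: "'a :: {real_normed_field, banach}"
  assumes b: "\<And>n. pochhammer b n \<noteq> 0"
  shows "hyp1F1 (b - a) b (- t) = exp (- t) * hyp1F1 a b t"
proof -
  have "(\<lambda>n. \<Sum>k\<le>n. (pochhammer a k / pochhammer b k * t ^ k / fact k) * ((- t) ^ (n - k) /\<^sub>R fact (n - k)))
          sums (hyp1F1 a b t * exp (- t))"
    unfolding hyp1F1_def exp_def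
    by (intro Cauchy_product_sums summable_norm_hyp1F1 summable_norm_exp)
  also have "(\<lambda>n. \<Sum>k\<le>n. (pochhammer a k / pochhammer b k * t ^ k / fact k) * ((- t) ^ (n - k) /\<^sub>R fact (n - k)))
     = (\<lambda>n. pochhammer (b - a) n / pochhammer b n * (- t) ^ n / fact n)"
  proof
    fix n
    have "(\<Sum>k\<le>n. (pochhammer a k / pochhammer b k * t ^ k / fact k) * ((- t) ^ (n - k) /\<^sub>R fact (n - k)))
      = (\<Sum>k\<le>n. (of_nat (n choose k) * (- 1) ^ k * pochhammer a k / pochhammer b k) * ((- t) ^ n / fact n))"
    proof (rule sum.cong[OF refl])
      fix k assume "k \<in> {..n}"
      then have k: "k \<le> n" by simp
      have 1: "(- t) ^ n = (- 1) ^ k * t ^ k * (- t) ^ (n - k)"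
        using k by (simp flip: power_mult_distrib power_add)
      have 2: "(of_nat (n choose k) :: 'a) / fact n = 1 / (fact k * fact (n - k))"
        using k by (simp add: binomial_fact)
      have "(of_nat (n choose k) * (- 1) ^ k * pochhammer a k / pochhammer b k) * ((- t) ^ n / fact n)
        = (of_nat (n choose k) / fact n) * ((- 1) ^ k * (- 1) ^ k) * (pochhammer a k / pochhammer b k * t ^ k * (- t) ^ (n - k))"
        by (simp add: 1 mult_ac)
      also have "(- 1) ^ k * (- 1) ^ k = (1 :: 'a)"
        by simp
      finally show "(pochhammer a k / pochhammer b k * t ^ k / fact k) * ((- t) ^ (n - k) /\<^sub>R fact (n - k))
         = (of_nat (n choose k) * (- 1) ^ k * pochhammer a k / pochhammer b k) * ((- t) ^ n / fact n)"
        unfolding 2 by (simp add: scaleR_conv_of_real field_simps)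
    qed
    also have "\<dots> = pochhammer (b - a) n / pochhammer b n * (- t) ^ n / fact n"
      unfolding sum_distrib_right[symmetric] chu_vandermonde[OF b] by simp
    finally show "(\<Sum>k\<le>n. (pochhammer a k / pochhammer b k * t ^ k / fact k) * ((- t) ^ (n - k) /\<^sub>R fact (n - k)))
      = pochhammer (b - a) n / pochhammer b n * (- t) ^ n / fact n" .
  qed
  finally have "(\<lambda>n. pochhammer (b - a) n / pochhammer b n * (- t) ^ n / fact n)
                   sums (hyp1F1 a b t * exp (- t))" .
  from sums_unique2[OF hyp1F1_sums this] show ?thesis
    by (simp add: mult.commute)
qed

section \<open>The weight and the backward shift of the Meixner polynomials\<close>

definition meixner_weight :: "real \<Rightarrow> real \<Rightarrow> nat \<Rightarrow> real" where
  "meixner_weight \<beta> c x = pochhammer \<beta> x * c ^ x / fact x"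

lemma meixner_weight_sums:
  assumes "0 \<le> c" "c < 1"
  shows "meixner_weight \<beta> c sums (1 - c) powr (- \<beta>)"
proof -
  have "(\<lambda>x. ((- \<beta>) gchoose x) * (- c) ^ x) sums (1 + - c) powr (- \<beta>)"
    using assms by (intro gen_binomial_real) auto
  also have "(\<lambda>x. ((- \<beta>) gchoose x) * (- c) ^ x) = meixner_weight \<beta> c"
    by (auto simp: fun_eq_iff meixner_weight_def gbinomial_pochhammer power_minus[of c] mult_ac)
  finally show ?thesis by simp
qed

lemma meixner_0: "meixner 0 x \<beta> c = 1"
  by (simp add: meixner_altdef)

lemma meixner_at_0: "meixner n 0 \<beta> c = 1"
  by (simp add: meixner_altdef pochhammer_0_left if_distrib if_distribR sum.If_cases cong: if_cong)

text \<open>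
  The free upper limit \<open>m\<close> lets Meixner polynomials of different degrees be compared over a
  common range of summation.
\<close>

lemma meixner_binomial:
  assumes "n \<le> m"
  shows "meixner n x \<beta> c = (\<Sum>k\<le>m. of_nat (n choose k) * pochhammer (- x) k / pochhammer \<beta> k * (1 / c - 1) ^ k)"
proof -
  have "meixner n x \<beta> c = (\<Sum>k\<le>n. of_nat (n choose k) * pochhammer (- x) k / pochhammer \<beta> k * (1 / c - 1) ^ k)"
    unfolding meixner_altdef
  proof (rule sum.cong[OF refl])
    fix k
    have "(1 / c - 1) ^ k = (- 1) ^ k * (1 - 1 / c) ^ k"
      by (simp flip: power_mult_distrib)
    then show "pochhammer (- real n) k * pochhammer (- x) k / (pochhammer \<beta> k * fact k) * (1 - 1 / c) ^ k
       = real (n choose k) * pochhammer (- x) k / pochhammer \<beta> k * (1 / c - 1) ^ k"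
      by (simp add: pochhammer_neg_nat[of n] mult_ac)
  qed
  also have "\<dots> = (\<Sum>k\<le>m. of_nat (n choose k) * pochhammer (- x) k / pochhammer \<beta> k * (1 / c - 1) ^ k)"
    using assms by (intro sum.mono_neutral_left) auto
  finally show ?thesis .
qed

text \<open>
  With \<open>p = 1 / c - 1\<close>, the factor \<open>1 / c\<close> on the right is \<open>1 + p\<close>, so that both sides are
  polynomials in \<open>p\<close>. Apart from the common factor \<open>(\<beta> + k) (-x)\<^sub>k / (\<beta> + 1)\<^sub>k\<close>, the coefficients of
  \<open>p\<^sup>k\<close> are binomial coefficients: \<open>n + 1\<close> over \<open>k\<close> on the left; on the right, the first term and the
  summand \<open>1\<close> of \<open>1 + p\<close> together give \<open>n\<close> over \<open>k\<close>, and the summand \<open>p\<close> gives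
  \<open>n\<close> over \<open>k - 1\<close>. Pascal's rule equates them.
\<close>

lemma meixner_contiguous:
  assumes \<beta>: "\<beta> > 0" and c: "c \<noteq> 0"
  shows "\<beta> * meixner (Suc n) x \<beta> c
           = (\<beta> + x) * meixner n x (\<beta> + 1) c - x / c * meixner n (x - 1) (\<beta> + 1) c"
proof -
  define p where "p = 1 / c - 1"
  define e where "e = (\<lambda>n x \<beta> k. of_nat (n choose k) * pochhammer (- x) k / pochhammer \<beta> k * p ^ k)"
  have M: "meixner n x \<beta> c = (\<Sum>k\<le>Suc n. e n x \<beta> k)" for x \<beta>
    unfolding e_def p_def by (rule meixner_binomial) simp
  have M': "meixner (Suc n) x \<beta> c = (\<Sum>k\<le>Suc n. e (Suc n) x \<beta> k)" for x \<beta>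
    unfolding e_def p_def by (rule meixner_binomial) simp
  define P where "P = (\<lambda>k. pochhammer (- x) k / pochhammer (\<beta> + 1) k)"
  have e_P: "e n x (\<beta> + 1) k = of_nat (n choose k) * P k * p ^ k" for k
    by (simp add: e_def P_def)
  have shift: "x * pochhammer (- (x - 1)) k = (x - of_nat k) * pochhammer (- x) k" for k
    using pochhammer_absorb_comp[of x k] by (simp add: algebra_simps)
  have up: "x * e n (x - 1) (\<beta> + 1) k = of_nat (n choose k) * (x - of_nat k) * P k * p ^ k" for k
    using shift[of k] by (simp add: e_def P_def mult_ac)
  have up': "x * e n (x - 1) (\<beta> + 1) k * p
      = - of_nat (n choose k) * (\<beta> + 1 + of_nat k) * P (Suc k) * p ^ Suc k" for k
  proof -
    have neg: "x * pochhammer (- (x - 1)) k = - pochhammer (- x) (Suc k)"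
      by (simp add: pochhammer_rec[of "- x"])
    have P_Suc: "pochhammer (- x) (Suc k) / pochhammer (\<beta> + 1) k = (\<beta> + 1 + of_nat k) * P (Suc k)"
      using \<beta> by (simp add: P_def pochhammer_Suc[of "\<beta> + 1"])
    have "x * e n (x - 1) (\<beta> + 1) k * p
        = of_nat (n choose k) * ((x * pochhammer (- (x - 1)) k) / pochhammer (\<beta> + 1) k) * p ^ Suc k"
      by (simp add: e_def mult_ac)
    also have "\<dots> = - of_nat (n choose k) * (pochhammer (- x) (Suc k) / pochhammer (\<beta> + 1) k) * p ^ Suc k"
      unfolding neg by simp
    finally show ?thesis
      unfolding P_Suc by (simp only: mult.assoc)
  qed
  have lhs: "\<beta> * e m x \<beta> k = of_nat (m choose k) * (\<beta> + of_nat k) * P k * p ^ k" for m k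
  proof -
    have "pochhammer \<beta> k * (\<beta> + of_nat k) = \<beta> * pochhammer (\<beta> + 1) k"
      using pochhammer_rec[of \<beta> k] pochhammer_Suc[of \<beta> k] by simp
    then have "\<beta> / pochhammer \<beta> k = (\<beta> + of_nat k) / pochhammer (\<beta> + 1) k"
      using pochhammer_pos[of \<beta> k] pochhammer_pos[of "\<beta> + 1" k] \<beta>
      by (simp add: field_simps)
    then show ?thesis
      by (simp add: e_def P_def) (metis (no_types, lifting) mult.commute mult.left_commute times_divide_eq_right)
  qed
  have "\<beta> * meixner (Suc n) x \<beta> c
        = (\<Sum>k\<le>Suc n. of_nat (Suc n choose k) * (\<beta> + of_nat k) * P k * p ^ k)"
    by (simp only: M' sum_distrib_left lhs)
  also have "\<dots> = \<beta> * P 0 + (\<Sum>k\<le>n. of_nat (n choose Suc k) * (\<beta> + of_nat (Suc k)) * P (Suc k) * p ^ Suc k)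
       + (\<Sum>k\<le>n. of_nat (n choose k) * (\<beta> + 1 + of_nat k) * P (Suc k) * p ^ Suc k)"
    by (subst sum.atMost_Suc_shift) (simp add: algebra_simps sum.distrib)
  also have "\<beta> * P 0 + (\<Sum>k\<le>n. of_nat (n choose Suc k) * (\<beta> + of_nat (Suc k)) * P (Suc k) * p ^ Suc k)
       = (\<Sum>k\<le>Suc n. of_nat (n choose k) * (\<beta> + of_nat k) * P k * p ^ k)"
    by (subst sum.atMost_Suc_shift) simp
  also have "\<dots> = (\<beta> + x) * meixner n x (\<beta> + 1) c - x * meixner n (x - 1) (\<beta> + 1) c"
    unfolding M sum_distrib_left sum_subtractf[symmetric] up e_P
    by (rule sum.cong[OF refl]) (simp add: algebra_simps)
  also have "(\<Sum>k\<le>n. of_nat (n choose k) * (\<beta> + 1 + of_nat k) * P (Suc k) * p ^ Suc k)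
       = - (\<Sum>k\<le>n. x * e n (x - 1) (\<beta> + 1) k * p)"
    unfolding up' by (simp add: sum_negf)
  also have "(\<Sum>k\<le>n. x * e n (x - 1) (\<beta> + 1) k * p) = x * p * meixner n (x - 1) (\<beta> + 1) c"
  proof -
    have "e n y (\<beta> + 1) (Suc n) = 0" for y
      by (simp add: e_def)
    then have "meixner n (x - 1) (\<beta> + 1) c = (\<Sum>k\<le>n. e n (x - 1) (\<beta> + 1) k)"
      by (simp add: M)
    then show ?thesis
      by (simp only: sum_distrib_left mult_ac)
  qed
  finally show ?thesis
    by (simp add: p_def algebra_simps)
qed

text \<open>
  This is one step of the discrete Rodrigues formula; together with \<open>meixner_at_0\<close>, by which
  both functions equal \<open>1\<close> at \<open>x = 0\<close>, it makes the left side a backward difference.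
  The three weights are multiples of a common quantity \<open>W\<close>, and \<open>meixner_contiguous\<close> is the relation
  between the factors.
\<close>

lemma meixner_backward_shift:
  assumes \<beta>: "\<beta> > 0" and c: "c \<noteq> 0"
  shows "meixner (Suc n) (real (Suc x)) \<beta> c * meixner_weight \<beta> c (Suc x)
           = meixner n (real (Suc x)) (\<beta> + 1) c * meixner_weight (\<beta> + 1) c (Suc x)
             - meixner n (real x) (\<beta> + 1) c * meixner_weight (\<beta> + 1) c x"
proof -
  define W where "W = meixner_weight \<beta> c (Suc x) / \<beta>"
  have W: "W = pochhammer (\<beta> + 1) x * c ^ Suc x / fact (Suc x)"
    using \<beta> by (simp add: W_def meixner_weight_def pochhammer_rec[of \<beta>])
  have w0: "meixner_weight \<beta> c (Suc x) = \<beta> * W"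
    using \<beta> by (simp add: W_def)
  have w1: "meixner_weight (\<beta> + 1) c (Suc x) = (\<beta> + real (Suc x)) * W"
    unfolding W by (simp add: meixner_weight_def pochhammer_Suc add_ac)
  have w2: "meixner_weight (\<beta> + 1) c x = real (Suc x) / c * W"
    using c unfolding W by (simp add: meixner_weight_def del: of_nat_Suc)
  have "meixner (Suc n) (real (Suc x)) \<beta> c * (\<beta> * W)
        = (\<beta> * meixner (Suc n) (real (Suc x)) \<beta> c) * W"
    by (simp only: mult_ac)
  also have "\<dots> = ((\<beta> + real (Suc x)) * meixner n (real (Suc x)) (\<beta> + 1) c
                   - real (Suc x) / c * meixner n (real (Suc x) - 1) (\<beta> + 1) c) * W"
    by (simp only: meixner_contiguous[OF \<beta> c])
  also have "real (Suc x) - 1 = real x"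
    by simp
  finally show ?thesis
    unfolding w0 w1 w2 by (simp only: right_diff_distrib left_diff_distrib mult_ac)
qed

section \<open>Growth estimates\<close>

lemma binomial_transform_bound:
  fixes d :: "nat \<Rightarrow> 'a :: real_normed_field"
  assumes "\<And>k. norm (d k) \<le> C * \<epsilon> ^ k"
  shows "norm (\<Sum>k\<le>x. of_nat (x choose k) * d k) \<le> C * (1 + \<epsilon>) ^ x"
proof -
  have "norm (\<Sum>k\<le>x. of_nat (x choose k) * d k) \<le> (\<Sum>k\<le>x. real (x choose k) * (C * \<epsilon> ^ k))"
    by (rule sum_norm_le) (auto simp: norm_mult intro!: mult_left_mono assms)
  also have "\<dots> = C * (1 + \<epsilon>) ^ x"
    by (simp add: binomial_ring[of \<epsilon> 1] sum_distrib_left mult_ac add.commute[of 1])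
  finally show ?thesis .
qed

text \<open>
  The coefficients \<open>(-z)\<^sup>k / (b)\<^sub>k\<close> are \<open>\<epsilon>\<^sup>k\<close> times the terms of the convergent series
  \<open>\<^sub>1F\<^sub>1(1; b; -z / \<epsilon>)\<close>, and these terms are bounded.
\<close>

lemma hyp1F1_neg_nat_growth:
  fixes b z :: "'a :: {real_normed_field, banach}"
  assumes "\<epsilon> > 0"
  obtains C where "\<And>x. norm (hyp1F1 (- of_nat x) b z) \<le> C * (1 + \<epsilon>) ^ x"
proof -
  define f where "f = (\<lambda>k. (- z / of_real \<epsilon>) ^ k / pochhammer b k)"
  have "f sums hyp1F1 1 b (- z / of_real \<epsilon>)"
    using hyp1F1_sums[of 1 b "- z / of_real \<epsilon>"] by (simp add: f_def flip: pochhammer_fact)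
  then have "f \<longlonglongrightarrow> 0"
    by (intro summable_LIMSEQ_zero) (auto simp: sums_iff)
  then have "Bseq f"
    by (intro convergent_imp_Bseq convergentI)
  then obtain C where C: "\<And>k. norm (f k) \<le> C"
    by (auto simp: Bseq_def)
  have "norm ((- z) ^ k / pochhammer b k) \<le> C * \<epsilon> ^ k" for k
  proof -
    have "norm ((- z) ^ k / pochhammer b k) = norm (f k) * \<epsilon> ^ k"
      using assms by (simp add: f_def norm_divide norm_power power_divide)
    also have "\<dots> \<le> C * \<epsilon> ^ k"
      using assms by (intro mult_right_mono C) simp
    finally show ?thesis .
  qed
  from binomial_transform_bound[of _ C \<epsilon>, OF this] show ?thesis
    by (intro that[of C]) (simp add: hyp1F1_neg_nat)
qed

text \<open>
  A polynomial in \<open>x\<close> is a binomial transform of a finitely supported sequence, so the same bound as for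
  the hypergeometric factor applies.
\<close>

lemma meixner_growth:
  assumes "\<epsilon> > 0"
  obtains C where "\<And>x. \<bar>meixner n (real x) \<beta> c\<bar> \<le> C * (1 + \<epsilon>) ^ x"
proof -
  define d where "d = (\<lambda>k. (- 1) ^ k * of_nat (n choose k) * fact k / pochhammer \<beta> k * (1 / c - 1) ^ k)"
  define C where "C = (\<Sum>k\<le>n. \<bar>d k\<bar> / \<epsilon> ^ k)"
  have bound: "norm (d k) \<le> C * \<epsilon> ^ k" for k
  proof (cases "k \<le> n")
    case True
    have "\<bar>d k\<bar> / \<epsilon> ^ k \<le> C"
      unfolding C_def by (rule member_le_sum) (use True assms in auto)
    then show ?thesis using assms by (simp add: field_simps)
  next
    case False
    then have "d k = 0" by (simp add: d_def)
    moreover have "C \<ge> 0" unfolding C_def using assms by (intro sum_nonneg) auto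
    ultimately show ?thesis using assms by simp
  qed
  have "meixner n (real x) \<beta> c = (\<Sum>k\<le>x. of_nat (x choose k) * d k)" for x
  proof -
    have "meixner n (real x) \<beta> c = (\<Sum>k\<le>max n x. of_nat (n choose k) * pochhammer (- real x) k / pochhammer \<beta> k * (1 / c - 1) ^ k)"
      by (rule meixner_binomial) simp
    also have "\<dots> = (\<Sum>k\<le>max n x. of_nat (x choose k) * d k)"
      by (rule sum.cong[OF refl])
         (simp add: d_def pochhammer_neg_nat[of x] mult_ac)
    also have "\<dots> = (\<Sum>k\<le>x. of_nat (x choose k) * d k)"
      by (rule sum.mono_neutral_right) auto
    finally show ?thesis .
  qed
  with binomial_transform_bound[of d C \<epsilon>, OF bound] show ?thesis
    by (intro that[of C]) simp
qed

text \<open>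
  This is the boundary term of the summation by parts.
\<close>

lemma hyp1F1_meixner_weight_tendsto_0:
  fixes b z :: complex
  assumes \<beta>: "\<beta> > 0" and c: "0 < c" "c < 1"
  shows "(\<lambda>x. hyp1F1 (- of_nat x) b z * of_real (meixner n (real x) \<beta> c * meixner_weight \<beta> c x))
           \<longlonglongrightarrow> 0"
proof -
  \<comment> \<open>Any \<open>\<epsilon> > 0\<close> with \<open>c (1 + \<epsilon>)\<^sup>2 < 1\<close> would do: one factor \<open>(1 + \<epsilon>)\<^sup>x\<close> is spent on each
     hypergeometric factor, and what remains is a term of the binomial series for \<open>r < 1\<close>.\<close>
  define \<epsilon> where "\<epsilon> = sqrt (2 / (1 + c)) - 1"
  have sq: "(1 + \<epsilon>) ^ 2 = 2 / (1 + c)" and \<epsilon>: "\<epsilon> > 0"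
    using c by (auto simp: \<epsilon>_def)
  define r where "r = c * (1 + \<epsilon>) ^ 2"
  have r: "0 \<le> r" "r < 1"
    using c by (simp_all add: r_def sq)
  obtain C1 where C1: "\<And>x. norm (hyp1F1 (- of_nat x) b z) \<le> C1 * (1 + \<epsilon>) ^ x"
    using hyp1F1_neg_nat_growth[OF \<epsilon>] by blast
  obtain C2 where C2: "\<And>x. \<bar>meixner n (real x) \<beta> c\<bar> \<le> C2 * (1 + \<epsilon>) ^ x"
    using meixner_growth[OF \<epsilon>] by blast
  have w: "meixner_weight \<beta> c x \<ge> 0" for x
    using c pochhammer_pos[OF \<beta>, of x] by (simp add: meixner_weight_def)
  show ?thesis
  proof (rule Lim_null_comparison)
    have "meixner_weight \<beta> r \<longlonglongrightarrow> 0"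
      using meixner_weight_sums[OF r] by (intro summable_LIMSEQ_zero) (auto simp: sums_iff)
    from tendsto_mult_left[OF this, of "C1 * C2"]
    show "(\<lambda>x. C1 * C2 * meixner_weight \<beta> r x) \<longlonglongrightarrow> 0" by simp
    have "norm (hyp1F1 (- of_nat x) b z * of_real (meixner n (real x) \<beta> c * meixner_weight \<beta> c x))
       \<le> C1 * C2 * meixner_weight \<beta> r x" for x
    proof -
      have "norm (hyp1F1 (- of_nat x) b z * of_real (meixner n (real x) \<beta> c * meixner_weight \<beta> c x))
        = norm (hyp1F1 (- of_nat x) b z) * \<bar>meixner n (real x) \<beta> c\<bar> * meixner_weight \<beta> c x"
        using w[of x] by (simp add: norm_mult)
      also have "\<dots> \<le> (C1 * (1 + \<epsilon>) ^ x) * (C2 * (1 + \<epsilon>) ^ x) * meixner_weight \<beta> c x"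
        using order_trans[OF norm_ge_zero C1[of x]]
        by (intro mult_right_mono mult_mono C1 C2 w) auto
      also have "\<dots> = C1 * C2 * meixner_weight \<beta> r x"
        by (simp add: meixner_weight_def r_def power_mult_distrib power2_eq_square)
      finally show ?thesis .
    qed
    then show "\<forall>\<^sub>F x in sequentially. norm (hyp1F1 (- of_nat x) b z *
        of_real (meixner n (real x) \<beta> c * meixner_weight \<beta> c x)) \<le> C1 * C2 * meixner_weight \<beta> r x"
      by simp
  qed
qed

section \<open>The case of degree zero\<close>

text \<open>
  Absolute convergence by rows makes the double series summable on \<open>\<nat> \<times> \<nat>\<close>, where it may be
  regrouped along the antidiagonals \<open>k + y = x\<close>. The Cauchy product is the case of a family \<open>g\<close> that
  is a product of two sequences.
\<close>

lemma sums_antidiagonals: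
  fixes g :: "nat \<Rightarrow> nat \<Rightarrow> 'a :: banach"
  assumes row: "\<And>k. (\<lambda>y. norm (g k y)) sums G k" and G: "summable G"
  shows "(\<lambda>x. \<Sum>k\<le>x. g k (x - k)) sums (\<Sum>k. \<Sum>y. g k y)"
proof -
  have G0: "G k \<ge> 0" for k
    using sums_le[OF _ sums_zero row[of k]] by simp
  have "((\<lambda>y. norm (g k y)) has_sum G k) UNIV" for k
    by (rule sums_nonneg_imp_has_sum[OF row]) simp
  then have "(\<lambda>p. norm (case p of (k, y) \<Rightarrow> g k y)) summable_on (SIGMA k:UNIV. UNIV)"
    by (intro summable_on_SigmaI[where g = G])
       (auto intro!: summable_nonneg_imp_summable_on G G0)
  then have abs: "(\<lambda>(k, y). g k y) summable_on (SIGMA k:UNIV. UNIV)"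
    by (rule abs_summable_summable)
  then obtain S where S: "((\<lambda>(k, y). g k y) has_sum S) (SIGMA k:UNIV. UNIV)"
    by (auto simp: summable_on_def)
  have "((\<lambda>y. g k y) has_sum (\<Sum>y. g k y)) UNIV" for k
    using sums_summable[OF row[of k]]
    by (intro norm_summable_imp_has_sum) (simp_all add: summable_sums summable_norm_cancel)
  with has_sum_SigmaD[OF S, of "\<lambda>k. \<Sum>y. g k y"] have "((\<lambda>k. \<Sum>y. g k y) has_sum S) UNIV"
    by simp
  then have S_eq: "S = (\<Sum>k. \<Sum>y. g k y)"
    by (rule sums_unique[OF has_sum_imp_sums])
  have "((\<lambda>(x, k). g k (x - k)) has_sum S) (SIGMA x:UNIV. {..x})"
    using S
    by (subst has_sum_reindex_bij_witness[where j = "\<lambda>(x, k). (k, x - k)" and i = "\<lambda>(k, y). (k + y, k)"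
          and S = "SIGMA x:UNIV. {..x}" and T = "SIGMA k:UNIV. UNIV" and h = "\<lambda>(k, y). g k y"])
       auto
  from has_sum_SigmaD[OF this, of "\<lambda>x. \<Sum>k\<le>x. g k (x - k)"]
  have "((\<lambda>x. \<Sum>k\<le>x. g k (x - k)) has_sum S) UNIV"
    by (simp add: has_sum_finite)
  then show ?thesis
    unfolding S_eq by (rule has_sum_imp_sums)
qed

text \<open>
  In the double series for the left side, put \<open>x = k + y\<close>. The term then factors as \<open>A k * w k y\<close>, since
  \<open>(\<beta>)\<^sub>k\<^sub>+\<^sub>y = (\<beta>)\<^sub>k (\<beta> + k)\<^sub>y\<close>. For fixed \<open>k\<close> the sum over \<open>y\<close> is the binomial series with value
  \<open>q k = (1 - c)\<^sup>-\<^sup>\<beta>\<^sup>-\<^sup>k\<close>. The products \<open>A k * q k\<close> are, up to a constant, the terms of a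
  \<open>\<^sub>1F\<^sub>1\<close> series, whose absolute convergence justifies the exchange of the sums.
\<close>

lemma hyp1F1_weight_sums:
  fixes z :: complex and \<alpha> \<beta> c :: real
  assumes \<alpha>: "\<alpha> > 0" and \<beta>: "\<beta> > 0" and c: "0 < c" "c < 1"
  shows "(\<lambda>x. hyp1F1 (- of_nat x) (of_real \<alpha>) z * of_real (meixner_weight \<beta> c x))
           sums (of_real ((1 - c) powr (- \<beta>)) *
                 hyp1F1 (of_real \<beta>) (of_real \<alpha>) (- z * of_real (c / (1 - c))))"
proof -
  define A where "A = (\<lambda>k. (- z) ^ k / pochhammer (of_real \<alpha>) k * of_real (meixner_weight \<beta> c k))"
  define w where "w = (\<lambda>k. meixner_weight (\<beta> + real k) c)"
  define s where "s = - z * of_real (c / (1 - c))"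
  define q where "q = (\<lambda>k. (1 - c) powr (- (\<beta> + real k)))"
  have w_sums: "w k sums q k" for k
    unfolding w_def q_def using c by (intro meixner_weight_sums) auto
  have w_nonneg: "w k y \<ge> 0" for k y
    using c \<beta> pochhammer_pos[of "\<beta> + real k" y] by (simp add: w_def meixner_weight_def)
  have A_q: "A k * of_real (q k) = of_real ((1 - c) powr (- \<beta>)) *
        (pochhammer (of_real \<beta>) k / pochhammer (of_real \<alpha>) k * s ^ k / fact k)" for k
  proof -
    have "q k = (1 - c) powr (- \<beta>) / (1 - c) ^ k"
      using c by (simp add: q_def powr_diff powr_realpow)
    moreover have "s ^ k = (- z) ^ k * (of_real c ^ k / (1 - of_real c) ^ k)"
      unfolding s_def power_mult_distrib by (simp add: power_divide)
    ultimately show ?thesis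
      by (simp add: A_def meixner_weight_def pochhammer_of_real mult_ac)
  qed
  have norm_A: "(\<lambda>y. norm (A k * of_real (w k y))) sums norm (A k * of_real (q k))" for k
    using sums_mult[OF w_sums[of k], of "norm (A k)"] w_nonneg
    by (simp add: norm_mult q_def)
  have "(\<lambda>x. \<Sum>k\<le>x. A k * of_real (w k (x - k))) sums (\<Sum>k. \<Sum>y. A k * of_real (w k y))"
  proof (rule sums_antidiagonals[OF norm_A])
    show "summable (\<lambda>k. norm (A k * of_real (q k)))"
      unfolding A_q norm_mult[of "of_real _"] by (intro summable_mult summable_norm_hyp1F1)
  qed
  also have "(\<lambda>k. \<Sum>y. A k * of_real (w k y)) = (\<lambda>k. A k * of_real (q k))"
    by (intro ext sums_unique[symmetric] sums_mult sums_of_real w_sums)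
  also have "(\<Sum>k. A k * of_real (q k)) = of_real ((1 - c) powr (- \<beta>)) * hyp1F1 (of_real \<beta>) (of_real \<alpha>) s"
    unfolding A_q by (intro sums_unique[symmetric] sums_mult hyp1F1_sums)
  also have "(\<lambda>x. \<Sum>k\<le>x. A k * of_real (w k (x - k)))
      = (\<lambda>x. hyp1F1 (- of_nat x) (of_real \<alpha>) z * of_real (meixner_weight \<beta> c x))"
  proof
    fix x
    have "A k * of_real (w k (x - k))
        = of_nat (x choose k) * ((- z) ^ k / pochhammer (of_real \<alpha>) k) * of_real (meixner_weight \<beta> c x)"
      if "k \<le> x" for k
    proof -
      have "meixner_weight \<beta> c k * w k (x - k) = real (x choose k) * meixner_weight \<beta> c x"
        using that pochhammer_product[OF that, of \<beta>]
        by (simp add: w_def meixner_weight_def binomial_fact flip: power_add)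
      from arg_cong[OF this, of complex_of_real] show ?thesis
        by (simp add: A_def)
    qed
    then show "(\<Sum>k\<le>x. A k * of_real (w k (x - k)))
       = hyp1F1 (- of_nat x) (of_real \<alpha>) z * of_real (meixner_weight \<beta> c x)"
      by (simp add: hyp1F1_neg_nat sum_distrib_right)
  qed
  finally show ?thesis
    by (simp add: s_def)
qed

section \<open>Lowering the degree\<close>

text \<open>
  The function \<open>u\<close> is the backward difference of \<open>v\<close>, with \<open>v\<close> continued by zero to \<open>x = -1\<close>.
\<close>

lemma sums_by_parts:
  fixes F v :: "nat \<Rightarrow> 'a :: real_normed_field"
  assumes u0: "u 0 = v 0" and u: "\<And>x. u (Suc x) = v (Suc x) - v x"
    and lim: "(\<lambda>x. F x * v x) \<longlonglongrightarrow> 0"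
    and sums: "(\<lambda>x. (F (Suc x) - F x) * v x) sums S"
  shows "(\<lambda>x. F x * u x) sums (- S)"
proof -
  have "(\<Sum>x<Suc N. F x * u x) = F N * v N - (\<Sum>x<N. (F (Suc x) - F x) * v x)" for N
    by (induction N) (simp_all add: u0 u algebra_simps)
  moreover have "(\<lambda>N. F N * v N - (\<Sum>x<N. (F (Suc x) - F x) * v x)) \<longlonglongrightarrow> 0 - S"
    by (intro tendsto_diff lim sums[unfolded sums_def])
  ultimately have "(\<lambda>N. \<Sum>x<Suc N. F x * u x) \<longlonglongrightarrow> - S"
    by (simp only: diff_0)
  then show ?thesis
    unfolding sums_def by (rule LIMSEQ_imp_Suc)
qed

text \<open>
  The parameters \<open>\<alpha>\<close> and \<open>\<beta>\<close> both grow by one whenever the degree drops by one, so the induction on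
  \<open>n\<close> generalizes over them. The factors \<open>z / \<alpha>, z / (\<alpha> + 1), \<dots>\<close> multiply up to
  \<open>z\<^sup>n / (\<alpha>)\<^sub>n\<close>.
\<close>

lemma hyp1F1_meixner_sums:
  fixes z :: complex and \<alpha> \<beta> c :: real
  assumes c: "0 < c" "c < 1" and \<alpha>: "\<alpha> > 0" and \<beta>: "\<beta> > 0"
  shows "(\<lambda>x. hyp1F1 (- of_nat x) (of_real \<alpha>) z * of_real (meixner n (real x) \<beta> c * meixner_weight \<beta> c x))
           sums (z ^ n / of_real (pochhammer \<alpha> n) *
                 (of_real ((1 - c) powr (- (\<beta> + real n))) *
                  hyp1F1 (of_real (\<beta> + real n)) (of_real (\<alpha> + real n)) (- z * of_real (c / (1 - c)))))"
  using \<alpha> \<beta>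
proof (induction n arbitrary: \<alpha> \<beta>)
  case 0
  then show ?case
    using hyp1F1_weight_sums[OF 0 c, of z] by (simp add: meixner_0)
next
  case (Suc n)
  define F where "F = (\<lambda>x. hyp1F1 (- of_nat x) (of_real \<alpha>) z)"
  define v where "v = (\<lambda>x. complex_of_real (meixner n (real x) (\<beta> + 1) c * meixner_weight (\<beta> + 1) c x))"
  define u where "u = (\<lambda>x. complex_of_real (meixner (Suc n) (real x) \<beta> c * meixner_weight \<beta> c x))"
  define S where "S = z ^ n / of_real (pochhammer (\<alpha> + 1) n) *
                 (of_real ((1 - c) powr (- (\<beta> + 1 + real n))) *
                  hyp1F1 (of_real (\<beta> + 1 + real n)) (of_real (\<alpha> + 1 + real n)) (- z * of_real (c / (1 - c))))"
  have diff: "F (Suc x) - F x = - (z / of_real \<alpha>) * hyp1F1 (- of_nat x) (of_real (\<alpha> + 1)) z" for x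
  proof -
    have "- complex_of_nat (Suc x) = - of_nat x - 1"
      by simp
    then show ?thesis
      unfolding F_def by (simp only: hyp1F1_diff_upper of_real_add of_real_1)
  qed
  have "(\<lambda>x. hyp1F1 (- of_nat x) (of_real (\<alpha> + 1)) z * v x) sums S"
    unfolding v_def S_def using Suc.prems by (intro Suc.IH) auto
  from sums_mult[OF this, of "- (z / of_real \<alpha>)"]
  have "(\<lambda>x. (F (Suc x) - F x) * v x) sums (- (z / of_real \<alpha>) * S)"
    by (simp add: diff mult.assoc)
  moreover have "u 0 = v 0"
    by (simp add: u_def v_def meixner_at_0 meixner_weight_def)
  moreover have "u (Suc x) = v (Suc x) - v x" for x
    using meixner_backward_shift[of \<beta> c n x] Suc.prems c
    unfolding u_def v_def of_real_diff[symmetric] by simp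
  moreover have "(\<lambda>x. F x * v x) \<longlonglongrightarrow> 0"
    unfolding F_def v_def using Suc.prems c by (intro hyp1F1_meixner_weight_tendsto_0) auto
  ultimately have "(\<lambda>x. F x * u x) sums - (- (z / of_real \<alpha>) * S)"
    by (intro sums_by_parts[where v = v])
  then show ?case
    by (simp add: F_def u_def S_def pochhammer_rec[of \<alpha>] add_ac mult_ac)
qed

text \<open>
  Kummer's transformation is applied with \<open>a = \<alpha> - \<beta>\<close> and \<open>b = \<alpha> + n\<close>, so that \<open>b - a = \<beta> + n\<close>.
\<close>

theorem corollary19:
  fixes n :: nat and t :: complex and \<alpha> \<beta> c :: real
  assumes "\<alpha> > 0" and "\<beta> > 0" and "0 < c" and "c < 1"
  shows "(\<lambda>x::nat. hyp1F1 (- of_nat x) (of_real \<alpha>) (t * of_real ((1 - c) / c))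
                    * of_real (meixner n (real x) \<beta> c)
                    * of_real (pochhammer \<beta> x * c ^ x / fact x))
         sums (t ^ n * exp (- t) / of_real ((1 - c) powr \<beta> * pochhammer \<alpha> n * c ^ n)
               * hyp1F1 (of_real (\<alpha> - \<beta>)) (of_real (\<alpha> + real n)) t)"
proof -
  define z where "z = t * of_real ((1 - c) / c)"
  have z: "- z * of_real (c / (1 - c)) = - t"
    using assms by (simp add: z_def)
  have "pochhammer (complex_of_real (\<alpha> + real n)) k \<noteq> 0" for k
    using pochhammer_pos[of "\<alpha> + real n" k] assms by (simp add: pochhammer_of_real del: of_real_add)
  from kummer_transformation[OF this, of "of_real (\<alpha> - \<beta>)" t]
  have kummer: "hyp1F1 (of_real (\<beta> + real n)) (of_real (\<alpha> + real n)) (- t)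
      = exp (- t) * hyp1F1 (of_real (\<alpha> - \<beta>)) (of_real (\<alpha> + real n)) t"
    by (simp add: algebra_simps)
  have "(1 - c) powr (- (\<beta> + real n)) = 1 / ((1 - c) powr \<beta> * (1 - c) ^ n)"
    using assms by (simp only: powr_minus_divide powr_add) (simp add: powr_realpow)
  moreover have "z ^ n = t ^ n * of_real ((1 - c) ^ n / c ^ n)"
    by (simp add: z_def power_mult_distrib power_divide)
  ultimately have const: "z ^ n / of_real (pochhammer \<alpha> n) * of_real ((1 - c) powr (- (\<beta> + real n)))
      = t ^ n / of_real ((1 - c) powr \<beta> * pochhammer \<alpha> n * c ^ n)"
    using assms by (simp add: mult_ac)
  show ?thesis
    using hyp1F1_meixner_sums[of c \<alpha> \<beta> z n] assms
    unfolding z kummer mult.assoc[symmetric] const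
    by (simp add: z_def meixner_weight_def mult_ac)
qed

end
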